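(* Let $G$ be a finitely generated group. Every subshift of finite type on $G$ is an effectively closed subshift.
   Context: Let $S\subset G$ be a finite generating set closed under inverses and containing $1_G$; words in $S^*$ represent elements of $G$. For a finite alphabet $A$, $A^G$ has the product topology and left shift action $(\sigma_g x)_h=x_{g^{-1}h}$; a subshift is a closed shift-invariant subset. Put $[a]_g=\{x\in A^G:x_g=a\}$. A pattern is an element $p\in A^F$ with $F\subset G$ finite, and $[p]_g=\bigcap_{h\in F}[p_h]_{gh}$. $X\subset A^G$ is of finite type if $X=\bigcap_{p\in\mathcal F,\,g\in G}A^G\setminus[p]_g$ for some finite set $\mathcal F$ of patterns. A pattern coding over $A$ is a finite set $c$ of pairs $(w,a)$ with $w\in S^*$, $a\in A$. For a set $\mathcal C$ of pattern codings, $X_{\mathcal C}=\bigcap_{g\in G,\,c\in\mathcal C}\big(A^G\setminus\bigcap_{(w,a)\in c}[a]_{gw}\big)$. $X\subset A^G$ is effectively closed if $X=X_{\mathcal C}$ for some recursively enumerable set $\mathcal C$ of pattern codings. *)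

theory Defs
  imports
    "HOL-Algebra.Generated_Groups"
    "HOL-Analysis.Function_Topology"
    "HOL-Library.Nat_Bijection"
    "HOL-Library.Countable_Set"
begin

section \<open>Recursively enumerable sets of natural numbers\<close>

text \<open>Kleene's \<open>\<mu>\<close>-recursive partial functions: syntax and input-output relation. Arguments are
  lists; arities are not tracked, \<open>Rec_Zero\<close> being the constant zero function of every arity.
  In \<open>Rec_Prim\<close> and \<open>Rec_Mu\<close>
  the recursion (respectively search) variable is the first argument, and the step function of
  \<open>Rec_Prim\<close> receives the counter, the previous value and the parameters, in this order.\<close>

datatype recf =
    Rec_Zero
  | Rec_Succ
  | Rec_Proj nat
  | Rec_Comp recf "recf list"
  | Rec_Prim recf recf
  | Rec_Mu recf

inductive computes :: "recf \<Rightarrow> nat list \<Rightarrow> nat \<Rightarrow> bool" where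
  computes_Zero: "computes Rec_Zero xs 0"
| computes_Succ: "computes Rec_Succ [x] (Suc x)"
| computes_Proj: "i < length xs \<Longrightarrow> computes (Rec_Proj i) xs (xs ! i)"
| computes_Comp: "list_all2 (\<lambda>g y. computes g xs y) gs ys \<Longrightarrow> computes f ys z
    \<Longrightarrow> computes (Rec_Comp f gs) xs z"
| computes_Prim_0: "computes f xs y \<Longrightarrow> computes (Rec_Prim f g) (0 # xs) y"
| computes_Prim_Suc: "computes (Rec_Prim f g) (n # xs) r \<Longrightarrow> computes g (n # r # xs) y
    \<Longrightarrow> computes (Rec_Prim f g) (Suc n # xs) y"
| computes_Mu: "computes f (n # xs) 0 \<Longrightarrow> (\<forall>i<n. \<exists>k. computes f (i # xs) (Suc k))
    \<Longrightarrow> computes (Rec_Mu f) xs n"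

lemma computes_deterministic: "computes f xs y \<Longrightarrow> computes f xs z \<Longrightarrow> y = z"
proof (induction f xs y arbitrary: z rule: computes.induct)
  case (computes_Comp xs gs ys f y)
  from computes_Comp.prems obtain ys' where
    ys': "list_all2 (\<lambda>g y. computes g xs y) gs ys'" "computes f ys' z"
    by (cases rule: computes.cases) simp_all
  have "ys = ys'"
    using computes_Comp.IH(1) ys'(1)
    by (intro nth_equalityI) (auto simp: list_all2_conv_all_nth)
  then show ?case using computes_Comp.IH(2) ys'(2) by simp
next
  case (computes_Prim_Suc f g n xs r y)
  from computes_Prim_Suc.prems obtain r' where
    "computes (Rec_Prim f g) (n # xs) r'" "computes g (n # r' # xs) z"
    by (cases rule: computes.cases) simp_all
  then show ?case using computes_Prim_Suc.IH by blast
next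
  case (computes_Mu f n xs)
  from computes_Mu.prems have z: "computes f (z # xs) 0"
    "\<forall>i<z. \<exists>k. computes f (i # xs) (Suc k)"
    by (cases rule: computes.cases; simp)+
  show ?case
  proof (rule linorder_cases[of n z])
    assume "n < z"
    then obtain k where "computes f (n # xs) (Suc k)" using z by blast
    then show ?thesis using computes_Mu.IH(1) by blast
  next
    assume "z < n"
    then show ?thesis using computes_Mu.IH(2) z(1) by blast
  qed
next
  case (computes_Zero xs)
  then show ?case by (cases rule: computes.cases) simp_all
next
  case (computes_Succ x)
  then show ?case by (cases rule: computes.cases) simp_all
next
  case (computes_Proj i xs)
  from computes_Proj.prems show ?case by (cases rule: computes.cases) simp_all
next
  case (computes_Prim_0 f xs y g)
  from computes_Prim_0.prems have "computes f xs z"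
    by (cases rule: computes.cases) simp_all
  then show ?case by (rule computes_Prim_0.IH)
qed

definition total_recursive :: "(nat \<Rightarrow> nat) \<Rightarrow> bool" where
  "total_recursive h \<longleftrightarrow> (\<exists>f. \<forall>n. computes f [n] (h n))"

definition recursively_enumerable :: "nat set \<Rightarrow> bool" where
  "recursively_enumerable E \<longleftrightarrow> E = {} \<or> (\<exists>h. total_recursive h \<and> E = range h)"


section \<open>Subshifts\<close>

definition full_shift :: "('g, 'm) monoid_scheme \<Rightarrow> 'a set \<Rightarrow> ('g \<Rightarrow> 'a) set" where
  "full_shift G A = carrier G \<rightarrow>\<^sub>E A"

definition full_shift_topology :: "('g, 'm) monoid_scheme \<Rightarrow> 'a set \<Rightarrow> ('g \<Rightarrow> 'a) topology" where
  "full_shift_topology G A = product_topology (\<lambda>_. discrete_topology A) (carrier G)"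

definition shift :: "('g, 'm) monoid_scheme \<Rightarrow> 'g \<Rightarrow> ('g \<Rightarrow> 'a) \<Rightarrow> 'g \<Rightarrow> 'a" where
  "shift G g x = (\<lambda>h\<in>carrier G. x (inv\<^bsub>G\<^esub> g \<otimes>\<^bsub>G\<^esub> h))"

definition subshift :: "('g, 'm) monoid_scheme \<Rightarrow> 'a set \<Rightarrow> ('g \<Rightarrow> 'a) set \<Rightarrow> bool" where
  "subshift G A X \<longleftrightarrow> closedin (full_shift_topology G A) X \<and>
    (\<forall>g\<in>carrier G. shift G g ` X \<subseteq> X)"

definition cylinder :: "('g, 'm) monoid_scheme \<Rightarrow> 'a set \<Rightarrow> 'a \<Rightarrow> 'g \<Rightarrow> ('g \<Rightarrow> 'a) set" where
  "cylinder G A a g = {x \<in> full_shift G A. x g = a}"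


subsection \<open>Subshifts of finite type\<close>

text \<open>A pattern \<open>p \<in> A\<^sup>F\<close> is a partial map with \<open>dom p = F\<close>. Here and below, intersections are
  taken inside the full shift, so that an empty intersection is the full shift.\<close>

definition patterns :: "('g, 'm) monoid_scheme \<Rightarrow> 'a set \<Rightarrow> ('g \<rightharpoonup> 'a) set" where
  "patterns G A = {p. finite (dom p) \<and> dom p \<subseteq> carrier G \<and> ran p \<subseteq> A}"

definition pattern_cylinder ::
    "('g, 'm) monoid_scheme \<Rightarrow> 'a set \<Rightarrow> ('g \<rightharpoonup> 'a) \<Rightarrow> 'g \<Rightarrow> ('g \<Rightarrow> 'a) set" where
  "pattern_cylinder G A p g =
    full_shift G A \<inter> (\<Inter>h\<in>dom p. cylinder G A (the (p h)) (g \<otimes>\<^bsub>G\<^esub> h))"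

definition finite_type :: "('g, 'm) monoid_scheme \<Rightarrow> 'a set \<Rightarrow> ('g \<Rightarrow> 'a) set \<Rightarrow> bool" where
  "finite_type G A X \<longleftrightarrow> (\<exists>\<F>. finite \<F> \<and> \<F> \<subseteq> patterns G A \<and>
    X = full_shift G A \<inter> (\<Inter>p\<in>\<F>. \<Inter>g\<in>carrier G. full_shift G A - pattern_cylinder G A p g))"


subsection \<open>Effectively closed subshifts\<close>

definition word_value :: "('g, 'm) monoid_scheme \<Rightarrow> 'g list \<Rightarrow> 'g" where
  "word_value G w = foldr (\<lambda>s t. s \<otimes>\<^bsub>G\<^esub> t) w \<one>\<^bsub>G\<^esub>"

definition pattern_codings :: "'g set \<Rightarrow> 'a set \<Rightarrow> ('g list \<times> 'a) set set" where
  "pattern_codings S A = {c. finite c \<and> c \<subseteq> lists S \<times> A}"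

definition coding_cylinder ::
    "('g, 'm) monoid_scheme \<Rightarrow> 'a set \<Rightarrow> ('g list \<times> 'a) set \<Rightarrow> 'g \<Rightarrow> ('g \<Rightarrow> 'a) set" where
  "coding_cylinder G A c g =
    full_shift G A \<inter> (\<Inter>(w, a)\<in>c. cylinder G A a (g \<otimes>\<^bsub>G\<^esub> word_value G w))"

definition coding_shift ::
    "('g, 'm) monoid_scheme \<Rightarrow> 'a set \<Rightarrow> ('g list \<times> 'a) set set \<Rightarrow> ('g \<Rightarrow> 'a) set" where
  "coding_shift G A C =
    full_shift G A \<inter> (\<Inter>g\<in>carrier G. \<Inter>c\<in>C. full_shift G A - coding_cylinder G A c g)"

text \<open>Goedel numbering of pattern codings. For finite \<open>S\<close>, the library function \<open>to_nat_on S\<close>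
  is a bijection from \<open>S\<close> onto \<open>{..<card S}\<close>. Which bijections number the finite sets \<open>S\<close> and
  \<open>A\<close> does not affect recursive enumerability, since a permutation of a finite set of symbols
  is computable. Words are formal: different words for one group element have different codes.\<close>

definition coding_number :: "'g set \<Rightarrow> 'a set \<Rightarrow> ('g list \<times> 'a) set \<Rightarrow> nat" where
  "coding_number S A c = set_encode
    ((\<lambda>(w, a). prod_encode (list_encode (map (to_nat_on S) w), to_nat_on A a)) ` c)"

lemma inj_on_coding_number:
  assumes "finite S" and "finite A"
  shows "inj_on (coding_number S A) (pattern_codings S A)"
proof -
  let ?e = "\<lambda>(w, a). prod_encode (list_encode (map (to_nat_on S) w), to_nat_on A a)"
  have S: "inj_on (to_nat_on S) S" and A: "inj_on (to_nat_on A) A"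
    using assms by (auto intro: countable_finite)
  have e: "inj_on ?e (lists S \<times> A)"
  proof (rule inj_onI, clarify)
    fix v a w b
    assume vw: "\<forall>x\<in>set v. x \<in> S" "\<forall>x\<in>set w. x \<in> S" and ab: "a \<in> A" "b \<in> A"
      and eq: "prod_encode (list_encode (map (to_nat_on S) v), to_nat_on A a) =
        prod_encode (list_encode (map (to_nat_on S) w), to_nat_on A b)"
    from eq have "map (to_nat_on S) v = map (to_nat_on S) w" and "to_nat_on A a = to_nat_on A b"
      by (simp_all add: list_encode_eq)
    moreover have "inj_on (to_nat_on S) (set v \<union> set w)"
      using vw by (intro inj_on_subset[OF S]) blast
    ultimately show "v = w \<and> a = b"
      using map_inj_on inj_onD[OF A] ab by blast
  qed
  show ?thesis
  proof (rule inj_onI)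
    fix c d
    assume cd: "c \<in> pattern_codings S A" "d \<in> pattern_codings S A"
      and eq: "coding_number S A c = coding_number S A d"
    then have "?e ` c = ?e ` d"
      by (simp add: coding_number_def pattern_codings_def set_encode_eq)
    then show "c = d"
      using cd inj_on_image_eq_iff[OF e] by (simp add: pattern_codings_def)
  qed
qed

definition effectively_closed ::
    "('g, 'm) monoid_scheme \<Rightarrow> 'g set \<Rightarrow> 'a set \<Rightarrow> ('g \<Rightarrow> 'a) set \<Rightarrow> bool" where
  "effectively_closed G S A X \<longleftrightarrow> (\<exists>C. C \<subseteq> pattern_codings S A \<and>
    recursively_enumerable (coding_number S A ` C) \<and> X = coding_shift G A C)"

end

theory Submission
  imports Defs
begin

text \<open>
  Finitely many forbidden patterns can be rewritten, one by one, as pattern codings: \<open>S\<close> is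
  symmetric and generates \<open>G\<close>, so every group element \<open>h\<close> is the value of some word \<open>w\<^sub>h\<close> over
  \<open>S\<close>, and replacing each position \<open>h\<close> of a pattern by \<open>w\<^sub>h\<close> changes neither the cylinders nor,
  therefore, the subshift (\<open>pattern_cylinder_eq_coding_cylinder\<close>). The words are merely chosen,
  not computed from the patterns. This is harmless: only finitely many words occur, so the
  resulting set of codings is finite, and a finite set of numbers is recursively enumerable
  because the finite table of its elements can be built into the enumerating function (\<open>finite_imp_recursively_enumerable\<close>).

  That the set is a subshift at all is topological: a pattern constrains finitely many
  coordinates, so its cylinders are open, and the cylinders of one pattern are permuted by the
  shift.
\<close>

lemma computes_constant: "\<exists>f. \<forall>xs. computes f xs c"
proof (induction c)
  case 0
  show ?case using computes_Zero by blast
next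
  case (Suc c)
  then obtain f where f: "computes f xs c" for xs by blast
  have "computes (Rec_Comp Rec_Succ [f]) xs (Suc c)" for xs
    by (rule computes_Comp[of _ _ "[c]"]) (simp_all add: f computes_Succ)
  then show ?case by blast
qed

text \<open>Primitive recursion whose step ignores the previous value is definition by cases on
  \<open>0\<close> and \<open>Suc n\<close>. Stacking such cases realises a finite table of values.\<close>

lemma total_recursive_case_nat:
  assumes "total_recursive h"
  shows "total_recursive (case_nat c h)"
proof -
  obtain k where k: "computes k [n] (h n)" for n
    using assms by (auto simp: total_recursive_def)
  obtain f where f: "computes f xs c" for xs
    using computes_constant by blast
  let ?r = "Rec_Prim f (Rec_Comp k [Rec_Proj 0])"
  have step: "computes (Rec_Comp k [Rec_Proj 0]) [n, r] (h n)" for n r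
    using computes_Proj[of 0 "[n, r]"]
    by (intro computes_Comp[of _ _ "[n]"]) (simp_all add: k)
  have "computes ?r [n] (case_nat c h n)" for n
  proof (induction n)
    case 0
    show ?case by (simp add: computes_Prim_0 f)
  next
    case (Suc n)
    show ?case using computes_Prim_Suc[OF Suc.IH step] by simp
  qed
  then show ?thesis by (auto simp: total_recursive_def)
qed

lemma range_case_nat: "range (case_nat c h) = insert c (range h)"
  by (auto simp: image_iff split: nat.splits)

lemma finite_imp_recursively_enumerable:
  assumes "finite E"
  shows "recursively_enumerable E"
proof (cases "E = {}")
  case True
  then show ?thesis by (simp add: recursively_enumerable_def)
next
  case False
  with assms have "\<exists>h. total_recursive h \<and> E = range h"
  proof (induction E rule: finite_ne_induct)
    case (singleton c)
    have "total_recursive (\<lambda>_. c)"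
      using computes_constant[of c] by (auto simp: total_recursive_def)
    then show ?case by (intro exI[of _ "\<lambda>_. c"]) auto
  next
    case (insert c E)
    then obtain h where "total_recursive h" and "E = range h" by blast
    then show ?case
      using total_recursive_case_nat range_case_nat by metis
  qed
  then show ?thesis by (simp add: recursively_enumerable_def)
qed


lemma topspace_full_shift_topology: "topspace (full_shift_topology G A) = full_shift G A"
  by (simp add: full_shift_topology_def full_shift_def)

text \<open>Being a coordinate projection's preimage of one symbol, a cylinder is open for the
  product topology.\<close>

lemma openin_cylinder:
  assumes "g \<in> carrier G"
  shows "openin (full_shift_topology G A) (cylinder G A a g)"
proof -
  have "continuous_map (full_shift_topology G A) (discrete_topology A) (\<lambda>x. x g)"
    unfolding full_shift_topology_def
    using continuous_map_product_projection[OF assms] by metis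
  then have "openin (full_shift_topology G A)
      {x \<in> topspace (full_shift_topology G A). x g \<in> {a} \<inter> A}"
    by (rule openin_continuous_map_preimage) simp
  also have "{x \<in> topspace (full_shift_topology G A). x g \<in> {a} \<inter> A} = cylinder G A a g"
    using assms by (auto simp: topspace_full_shift_topology cylinder_def full_shift_def)
  finally show ?thesis .
qed

lemma mem_pattern_cylinder_iff:
  "x \<in> pattern_cylinder G A p g \<longleftrightarrow>
    x \<in> full_shift G A \<and> (\<forall>h\<in>dom p. x (g \<otimes>\<^bsub>G\<^esub> h) = the (p h))"
  by (auto simp: pattern_cylinder_def cylinder_def)

context group
begin

text \<open>Finiteness of the domain of \<open>p\<close> is what makes this intersection of cylinders open.\<close>

lemma openin_pattern_cylinder:
  assumes "p \<in> patterns G A" and "g \<in> carrier G"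
  shows "openin (full_shift_topology G A) (pattern_cylinder G A p g)"
proof -
  have "openin (full_shift_topology G A)
      ((\<Inter>h\<in>dom p. cylinder G A (the (p h)) (g \<otimes> h)) \<inter> topspace (full_shift_topology G A))"
    using assms by (intro openin_INT openin_cylinder) (auto simp: patterns_def)
  then show ?thesis
    by (simp add: pattern_cylinder_def topspace_full_shift_topology Int_commute)
qed

lemma shift_in_full_shift:
  assumes "g \<in> carrier G" and "x \<in> full_shift G A"
  shows "shift G g x \<in> full_shift G A"
  using assms by (auto simp: shift_def full_shift_def)

text \<open>An occurrence of \<open>p\<close> at \<open>k\<close> in \<open>\<sigma>\<^sub>g x\<close> is an occurrence of \<open>p\<close> at \<open>g\<^sup>-\<^sup>1k\<close> in \<open>x\<close>. So a
  configuration avoiding \<open>p\<close> at every position has only shifts that do the same.\<close>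

lemma pattern_cylinder_shift:
  assumes "p \<in> patterns G A" and "g \<in> carrier G" and "k \<in> carrier G" and "x \<in> full_shift G A"
    and "shift G g x \<in> pattern_cylinder G A p k"
  shows "x \<in> pattern_cylinder G A p (inv g \<otimes> k)"
proof -
  have "x (inv g \<otimes> k \<otimes> h) = the (p h)" if "h \<in> dom p" for h
  proof -
    have "h \<in> carrier G" using assms(1) that by (auto simp: patterns_def)
    then have "x (inv g \<otimes> k \<otimes> h) = shift G g x (k \<otimes> h)"
      using assms(2,3) by (simp add: shift_def m_assoc)
    also have "\<dots> = the (p h)"
      using assms(5) that by (simp add: mem_pattern_cylinder_iff)
    finally show ?thesis .
  qed
  with assms(4) show ?thesis by (simp add: mem_pattern_cylinder_iff)
qed

lemma subshift_if_finite_type: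
  assumes "finite_type G A X"
  shows "subshift G A X"
proof -
  obtain \<F> where \<F>: "\<F> \<subseteq> patterns G A"
    and X: "X = full_shift G A \<inter>
      (\<Inter>p\<in>\<F>. \<Inter>g\<in>carrier G. full_shift G A - pattern_cylinder G A p g)"
    using assms by (auto simp: finite_type_def)
  have "openin (full_shift_topology G A) (\<Union>p\<in>\<F>. \<Union>g\<in>carrier G. pattern_cylinder G A p g)"
    using \<F> openin_pattern_cylinder by (intro openin_Union) blast+
  moreover have
    "X = topspace (full_shift_topology G A) - (\<Union>p\<in>\<F>. \<Union>g\<in>carrier G. pattern_cylinder G A p g)"
    by (auto simp: X topspace_full_shift_topology)
  ultimately have "closedin (full_shift_topology G A) X"
    by (simp add: closedin_diff)
  moreover have "shift G g x \<in> X" if g: "g \<in> carrier G" and x: "x \<in> X" for g x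
  proof -
    have full: "x \<in> full_shift G A" using x by (simp add: X)
    have "shift G g x \<notin> pattern_cylinder G A p k" if "p \<in> \<F>" and k: "k \<in> carrier G" for p k
    proof
      assume "shift G g x \<in> pattern_cylinder G A p k"
      then have "x \<in> pattern_cylinder G A p (inv g \<otimes> k)"
        using pattern_cylinder_shift \<F> \<open>p \<in> \<F>\<close> g k full by blast
      moreover have "inv g \<otimes> k \<in> carrier G" using g k by simp
      ultimately show False using x \<open>p \<in> \<F>\<close> unfolding X by blast
    qed
    then show ?thesis using shift_in_full_shift[OF g full] by (simp add: X)
  qed
  ultimately show ?thesis by (auto simp: subshift_def)
qed


lemma word_value_closed: "w \<in> lists (carrier G) \<Longrightarrow> word_value G w \<in> carrier G"
  by (induction w) (auto simp: word_value_def)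

lemma word_value_append:
  assumes "u \<in> lists (carrier G)" and "v \<in> lists (carrier G)"
  shows "word_value G (u @ v) = word_value G u \<otimes> word_value G v"
  using assms(1)
proof (induction u)
  case Nil
  show ?case using word_value_closed[OF assms(2)] by (simp add: word_value_def)
next
  case (Cons s u)
  then show ?case
    using word_value_closed[of u] word_value_closed[OF assms(2)]
    by (simp add: word_value_def m_assoc)
qed

text \<open>Words have letters in \<open>S\<close> only, whereas \<open>generate\<close> also allows inverses of generators;
  closure of \<open>S\<close> under inverses turns these into letters, and concatenation realises
  products.\<close>

lemma generate_imp_word_value:
  assumes "S \<subseteq> carrier G" and "\<And>s. s \<in> S \<Longrightarrow> inv s \<in> S" and "h \<in> generate G S"
  shows "\<exists>w\<in>lists S. word_value G w = h"
  using assms(3)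
proof (induction rule: generate.induct)
  case one
  show ?case by (intro bexI[of _ "[]"]) (auto simp: word_value_def)
next
  case (incl s)
  then show ?case using assms(1) by (intro bexI[of _ "[s]"]) (auto simp: word_value_def)
next
  case (inv s)
  then show ?case using assms(1,2) by (intro bexI[of _ "[inv s]"]) (auto simp: word_value_def)
next
  case (eng h k)
  then obtain u v where "u \<in> lists S" "v \<in> lists S" "word_value G u = h" "word_value G v = k"
    by blast
  moreover from this have "word_value G (u @ v) = h \<otimes> k"
    using word_value_append lists_mono[OF assms(1)] by blast
  ultimately show ?case by (intro bexI[of _ "u @ v"]) auto
qed

end

text \<open>Here \<open>\<omega>\<close> assigns to each position of \<open>p\<close> a word representing it. A coding only sees
  its words through their values, so it then imposes the same constraints as \<open>p\<close>.\<close>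

lemma pattern_cylinder_eq_coding_cylinder:
  assumes "\<And>h. h \<in> dom p \<Longrightarrow> word_value G (\<omega> h) = h"
  shows "coding_cylinder G A ((\<lambda>h. (\<omega> h, the (p h))) ` dom p) g = pattern_cylinder G A p g"
  using assms by (simp add: coding_cylinder_def pattern_cylinder_def)

lemma pattern_coding_of_pattern:
  assumes "p \<in> patterns G A" and "\<And>h. h \<in> carrier G \<Longrightarrow> \<omega> h \<in> lists S"
  shows "(\<lambda>h. (\<omega> h, the (p h))) ` dom p \<in> pattern_codings S A"
  using assms by (force simp: patterns_def pattern_codings_def intro: ranI)

theorem proposition2p4:
  fixes G :: "('g, 'm) monoid_scheme" and S :: "'g set"
    and A :: "'a set" and X :: "('g \<Rightarrow> 'a) set"
  assumes "group G"
    and "finite S" and "S \<subseteq> carrier G" and "generate G S = carrier G"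
    and "\<And>s. s \<in> S \<Longrightarrow> inv\<^bsub>G\<^esub> s \<in> S" and "\<one>\<^bsub>G\<^esub> \<in> S"
    and "finite A"
    and "finite_type G A X"
  shows "subshift G A X \<and> effectively_closed G S A X"
proof
  interpret group G by (rule assms(1))
  show "subshift G A X" by (rule subshift_if_finite_type[OF assms(8)])
  have "\<forall>h\<in>carrier G. \<exists>w. w \<in> lists S \<and> word_value G w = h"
    using generate_imp_word_value[OF assms(3,5)] assms(4) by blast
  then obtain \<omega>
    where \<omega>: "\<omega> h \<in> lists S" "word_value G (\<omega> h) = h" if "h \<in> carrier G" for h
    by metis
  obtain \<F> where \<F>: "finite \<F>" "\<F> \<subseteq> patterns G A"
    and X: "X = full_shift G A \<inter>
      (\<Inter>p\<in>\<F>. \<Inter>g\<in>carrier G. full_shift G A - pattern_cylinder G A p g)"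
    using assms(8) by (auto simp: finite_type_def)
  let ?code = "\<lambda>p. (\<lambda>h. (\<omega> h, the (p h))) ` dom p"
  have "?code ` \<F> \<subseteq> pattern_codings S A"
    using \<F>(2) \<omega>(1) pattern_coding_of_pattern by blast
  moreover have "recursively_enumerable (coding_number S A ` ?code ` \<F>)"
    using \<F>(1) by (intro finite_imp_recursively_enumerable) simp
  moreover have "X = coding_shift G A (?code ` \<F>)"
  proof -
    have "coding_cylinder G A (?code p) g = pattern_cylinder G A p g" if "p \<in> \<F>" for p g
      using that \<F>(2) \<omega>(2) by (intro pattern_cylinder_eq_coding_cylinder) (auto simp: patterns_def)
    then show ?thesis by (auto simp: X coding_shift_def)
  qed
  ultimately show "effectively_closed G S A X"
    unfolding effectively_closed_def by blast
qed

end
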